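(* For a positive integer $a$, let $\mathbb{Z}^{(a)}$ denote the commutative unital truss on the set $\mathbb{Z}$ with ternary heap operation $[k,l,m]=k-l+m$ and multiplication $m\cdot n=amn+m+n$ for all $m,n\in\mathbb{Z}$. (1) For every positive integer $a$ and every positive integer $N$, the set $N\mathbb{Z}=\{mN\;|\;m\in\mathbb{Z}\}$ is a paragon in $\mathbb{Z}^{(a)}$. (2) For all integers $k\geq 1$, the quotient truss $\mathbb{Z}^{(2)}/2^{k+1}\mathbb{Z}$ is a unital truss in which every element is a unit (hence a brace), and its group of units satisfies $$\mathrm{U}\left(\mathbb{Z}^{(2)}/2^{k+1}\mathbb{Z}\right)\cong C_2\oplus C_{2^k}.$$
   Context: A truss is a set $T$ with a ternary operation $[-,-,-]$ making it an abelian heap (i.e. $[[a,b,c],d,e]=[a,b,[c,d,e]]$, $[b,b,a]=a=[a,b,b]$, $[a,b,c]=[c,b,a]$) and an associative multiplication distributing over the ternary operation from both sides: $a[b,c,d]=[ab,ac,ad]$, $[b,c,d]a=[ba,ca,da]$. It is unital if it has a multiplicative identity (the identity of $\mathbb{Z}^{(a)}$ is $0$), and $\mathrm{U}(T)$ is the group of invertible elements. A paragon in $T$ is a subset $P$ closed under $[-,-,-]$ for which there exists $q\in P$ such that $[xp,xq,q]\in P$ and $[px,qx,q]\in P$ for all $x\in T$, $p\in P$. For a paragon $P$, $x\sim_P y\iff\exists\,p\in P,\ [x,y,p]\in P$ is a congruence on $T$ and $T/P$ is the quotient truss. A two-sided brace is a set $B$ with an abelian group operation $+$ and a group operation $\cdot$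 such that $a(b+c)=ab-a+ac$ and $(b+c)a=ba-a+ca$; a truss in which multiplication is a group operation is a two-sided brace with addition $x+y=[x,1,y]$, where $1$ denotes the multiplicative identity. $C_n$ denotes the cyclic group of order $n$. *)

theory Defs
  imports "HOL-Algebra.Ring" "HOL-Algebra.Elementary_Groups"
begin

text \<open>
  The ternary operation is added to the \<^typ>\<open>'a monoid\<close> record, so that the multiplicative
  structure of a truss can be used with the group library. The field \<^const>\<open>one\<close> is constrained
  only by \<open>unital_truss\<close>; the axioms of a truss do not mention it.
\<close>

record 'a truss = "'a monoid" +
  tern :: "'a \<Rightarrow> 'a \<Rightarrow> 'a \<Rightarrow> 'a"

locale abelian_heap =
  fixes T (structure)
  assumes tern_closed:
      "\<lbrakk>a \<in> carrier T; b \<in> carrier T; c \<in> carrier T\<rbrakk> \<Longrightarrow> tern T a b c \<in> carrier T"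
    and tern_assoc:
      "\<lbrakk>a \<in> carrier T; b \<in> carrier T; c \<in> carrier T; d \<in> carrier T; e \<in> carrier T\<rbrakk>
        \<Longrightarrow> tern T (tern T a b c) d e = tern T a b (tern T c d e)"
    and tern_malcev_left: "\<lbrakk>a \<in> carrier T; b \<in> carrier T\<rbrakk> \<Longrightarrow> tern T b b a = a"
    and tern_malcev_right: "\<lbrakk>a \<in> carrier T; b \<in> carrier T\<rbrakk> \<Longrightarrow> tern T a b b = a"
    and tern_comm:
      "\<lbrakk>a \<in> carrier T; b \<in> carrier T; c \<in> carrier T\<rbrakk> \<Longrightarrow> tern T a b c = tern T c b a"

locale truss = abelian_heap T for T (structure) +
  assumes mult_closed: "\<lbrakk>a \<in> carrier T; b \<in> carrier T\<rbrakk> \<Longrightarrow> a \<otimes> b \<in> carrier T"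
    and mult_assoc:
      "\<lbrakk>a \<in> carrier T; b \<in> carrier T; c \<in> carrier T\<rbrakk> \<Longrightarrow> (a \<otimes> b) \<otimes> c = a \<otimes> (b \<otimes> c)"
    and distrib_left:
      "\<lbrakk>a \<in> carrier T; b \<in> carrier T; c \<in> carrier T; d \<in> carrier T\<rbrakk>
        \<Longrightarrow> a \<otimes> tern T b c d = tern T (a \<otimes> b) (a \<otimes> c) (a \<otimes> d)"
    and distrib_right:
      "\<lbrakk>a \<in> carrier T; b \<in> carrier T; c \<in> carrier T; d \<in> carrier T\<rbrakk>
        \<Longrightarrow> tern T b c d \<otimes> a = tern T (b \<otimes> a) (c \<otimes> a) (d \<otimes> a)"

locale unital_truss = truss T + monoid T for T (structure)

locale comm_unital_truss = unital_truss T + comm_monoid T for T (structure)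

definition paragon :: "'a set \<Rightarrow> ('a, 'b) truss_scheme \<Rightarrow> bool" where
  "paragon P T \<longleftrightarrow>
     P \<subseteq> carrier T \<and>
     (\<forall>x\<in>P. \<forall>y\<in>P. \<forall>z\<in>P. tern T x y z \<in> P) \<and>
     (\<exists>q\<in>P. \<forall>x\<in>carrier T. \<forall>p\<in>P.
        tern T (x \<otimes>\<^bsub>T\<^esub> p) (x \<otimes>\<^bsub>T\<^esub> q) q \<in> P \<and> tern T (p \<otimes>\<^bsub>T\<^esub> x) (q \<otimes>\<^bsub>T\<^esub> x) q \<in> P)"

definition paragon_rel :: "('a, 'b) truss_scheme \<Rightarrow> 'a set \<Rightarrow> ('a \<times> 'a) set" where
  "paragon_rel T P = {(x, y). x \<in> carrier T \<and> y \<in> carrier T \<and> (\<exists>p\<in>P. tern T x y p \<in> P)}"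

text \<open>
  Each operation on classes is the union of the classes of all results on representatives,
  as in \<^theory>\<open>HOL.Equiv_Relations\<close>. For a congruence this union is a single class.
\<close>

definition quotient_truss :: "('a, 'b) truss_scheme \<Rightarrow> 'a set \<Rightarrow> 'a set truss" where
  "quotient_truss T P =
     \<lparr>carrier = carrier T // paragon_rel T P,
      monoid.mult = (\<lambda>A B. \<Union>a\<in>A. \<Union>b\<in>B. paragon_rel T P `` {a \<otimes>\<^bsub>T\<^esub> b}),
      one = paragon_rel T P `` {\<one>\<^bsub>T\<^esub>},
      tern = (\<lambda>A B C. \<Union>a\<in>A. \<Union>b\<in>B. \<Union>c\<in>C. paragon_rel T P `` {tern T a b c})\<rparr>"

text \<open>
  A brace is carried by a \<^typ>\<open>'a ring\<close> record; \<open>\<zero>\<close> is the neutral element of \<open>\<oplus>\<close> and \<open>\<one>\<close>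
  that of \<open>\<otimes>\<close> (the brace axioms force the two to coincide).
\<close>

locale two_sided_brace = abelian_group B + group B for B (structure) +
  assumes brace_left:
      "\<lbrakk>a \<in> carrier B; b \<in> carrier B; c \<in> carrier B\<rbrakk>
        \<Longrightarrow> a \<otimes> (b \<oplus> c) = ((a \<otimes> b) \<ominus> a) \<oplus> (a \<otimes> c)"
    and brace_right:
      "\<lbrakk>a \<in> carrier B; b \<in> carrier B; c \<in> carrier B\<rbrakk>
        \<Longrightarrow> (b \<oplus> c) \<otimes> a = ((b \<otimes> a) \<ominus> a) \<oplus> (c \<otimes> a)"

definition brace_of_truss :: "('a, 'b) truss_scheme \<Rightarrow> 'a ring" where
  "brace_of_truss T =
     \<lparr>carrier = carrier T, monoid.mult = monoid.mult T, one = \<one>\<^bsub>T\<^esub>,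
      zero = \<one>\<^bsub>T\<^esub>, add = (\<lambda>x y. tern T x \<one>\<^bsub>T\<^esub> y)\<rparr>"

definition int_truss :: "int \<Rightarrow> int truss" where
  "int_truss a =
     \<lparr>carrier = UNIV, monoid.mult = (\<lambda>m n. a * m * n + m + n), one = 0, tern = (\<lambda>k l m. k - l + m)\<rparr>"

definition int_multiples :: "int \<Rightarrow> int set" where
  "int_multiples N = {m * N | m. m \<in> UNIV}"

end

theory Submission
  imports Defs "HOL-Number_Theory.Residue_Primitive_Roots"
begin

text \<open>
  The map \<open>m \<mapsto> 1 + 2 m\<close> turns the multiplication \<open>2 m n + m + n\<close> into ordinary multiplication
  of odd integers, and \<open>m\<close> is determined modulo \<open>2\<^sup>k\<^sup>+\<^sup>1\<close> by \<open>1 + 2 m\<close> modulo \<open>2\<^sup>k\<^sup>+\<^sup>2\<close>. So the quotient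
  is, multiplicatively, the group of odd residues modulo \<open>2\<^sup>k\<^sup>+\<^sup>2\<close>, which is the direct product of the
  subgroups generated by \<open>-1\<close> (of order \<open>2\<close>) and by \<open>5\<close> (of order \<open>2\<^sup>k\<close>).
\<close>

section \<open>Trusses and braces\<close>

text \<open>The truss axioms are identities, so they pass along any surjection that commutes with
  the operations. Injectivity of \<open>f\<close> is not assumed, so \<open>f\<close> may be the map
  to classes in a quotient.\<close>

lemma unital_truss_image:
  fixes T :: "('a, 'c) truss_scheme" and Q :: "('b, 'd) truss_scheme"
  assumes T: "unital_truss T"
    and carrier: "carrier Q = f ` carrier T"
    and mult: "\<And>x y. \<lbrakk>x \<in> carrier T; y \<in> carrier T\<rbrakk> \<Longrightarrow> f x \<otimes>\<^bsub>Q\<^esub> f y = f (x \<otimes>\<^bsub>T\<^esub> y)"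
    and one: "\<one>\<^bsub>Q\<^esub> = f \<one>\<^bsub>T\<^esub>"
    and tern: "\<And>x y z. \<lbrakk>x \<in> carrier T; y \<in> carrier T; z \<in> carrier T\<rbrakk>
      \<Longrightarrow> tern Q (f x) (f y) (f z) = f (tern T x y z)"
  shows "unital_truss Q"
proof -
  interpret T: unital_truss T by (rule T)
  note ops = carrier mult one tern
  show ?thesis
  proof unfold_locales
    show "tern Q a b c \<in> carrier Q"
      if "a \<in> carrier Q" "b \<in> carrier Q" "c \<in> carrier Q" for a b c
      using that by (auto simp: ops T.tern_closed)
    show "tern Q (tern Q a b c) d e = tern Q a b (tern Q c d e)"
      if "a \<in> carrier Q" "b \<in> carrier Q" "c \<in> carrier Q" "d \<in> carrier Q" "e \<in> carrier Q"
      for a b c d e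
      using that by (auto simp: ops T.tern_closed T.tern_assoc)
    show "tern Q b b a = a" if "a \<in> carrier Q" "b \<in> carrier Q" for a b
      using that by (auto simp: ops T.tern_malcev_left)
    show "tern Q a b b = a" if "a \<in> carrier Q" "b \<in> carrier Q" for a b
      using that by (auto simp: ops T.tern_malcev_right)
    show "tern Q a b c = tern Q c b a"
      if "a \<in> carrier Q" "b \<in> carrier Q" "c \<in> carrier Q" for a b c
      using that T.tern_comm by (auto simp: ops intro!: arg_cong[of _ _ f])
    show "a \<otimes>\<^bsub>Q\<^esub> tern Q b c d = tern Q (a \<otimes>\<^bsub>Q\<^esub> b) (a \<otimes>\<^bsub>Q\<^esub> c) (a \<otimes>\<^bsub>Q\<^esub> d)"
      if "a \<in> carrier Q" "b \<in> carrier Q" "c \<in> carrier Q" "d \<in> carrier Q" for a b c d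
      using that by (auto simp: ops T.tern_closed T.distrib_left)
    show "tern Q b c d \<otimes>\<^bsub>Q\<^esub> a = tern Q (b \<otimes>\<^bsub>Q\<^esub> a) (c \<otimes>\<^bsub>Q\<^esub> a) (d \<otimes>\<^bsub>Q\<^esub> a)"
      if "a \<in> carrier Q" "b \<in> carrier Q" "c \<in> carrier Q" "d \<in> carrier Q" for a b c d
      using that by (auto simp: ops T.tern_closed T.distrib_right)
  qed (auto simp: ops T.m_assoc)
qed

lemma two_sided_brace_brace_of_truss:
  fixes T :: "('a, 'b) truss_scheme"
  assumes T: "unital_truss T" and Units: "Units T = carrier T"
  shows "two_sided_brace (brace_of_truss T)"
proof -
  interpret T: unital_truss T by (rule T)
  let ?B = "brace_of_truss T"
  note B = brace_of_truss_def
  note malcev = T.tern_malcev_left T.tern_malcev_right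
  have B_abelian: "abelian_group ?B"
  proof (rule abelian_groupI)
    fix x y assume "x \<in> carrier ?B" "y \<in> carrier ?B"
    then show "x \<oplus>\<^bsub>?B\<^esub> y = y \<oplus>\<^bsub>?B\<^esub> x"
      by (auto simp: B intro: T.tern_comm)
  next
    fix x assume "x \<in> carrier ?B"
    then show "\<exists>y\<in>carrier ?B. y \<oplus>\<^bsub>?B\<^esub> x = \<zero>\<^bsub>?B\<^esub>"
      \<comment> \<open>The negative of \<open>x\<close> is its reflection in 1: reassociating,
        [[1,x,1],1,x] = [1,x,[1,1,x]] = [1,x,x] = 1.\<close>
      by (intro bexI[of _ "tern T \<one>\<^bsub>T\<^esub> x \<one>\<^bsub>T\<^esub>"]) (auto simp: B T.tern_closed T.tern_assoc malcev)
  qed (auto simp: B T.tern_closed T.tern_assoc malcev)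
  have B_group: "group ?B"
    using Units T.Units_l_inv_ex by (intro groupI) (auto simp: B T.m_assoc)
  interpret B: abelian_group ?B by (rule B_abelian)
  have neg: "\<ominus>\<^bsub>?B\<^esub> x = tern T \<one>\<^bsub>T\<^esub> x \<one>\<^bsub>T\<^esub>" if "x \<in> carrier T" for x
    using that by (intro B.minus_equality) (auto simp: B T.tern_closed T.tern_assoc malcev)
  \<comment> \<open>The derived addition gives the heap operation back. Hence both brace laws are
    truss distributivity with middle entry 1, such as a[b,1,c] = [ab,a,ac].\<close>
  have sub_add: "(x \<ominus>\<^bsub>?B\<^esub> y) \<oplus>\<^bsub>?B\<^esub> z = tern T x y z"
    if "x \<in> carrier T" "y \<in> carrier T" "z \<in> carrier T" for x y z
  proof -
    have "(x \<ominus>\<^bsub>?B\<^esub> y) \<oplus>\<^bsub>?B\<^esub> z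
        = tern T (tern T x \<one>\<^bsub>T\<^esub> (tern T \<one>\<^bsub>T\<^esub> y \<one>\<^bsub>T\<^esub>)) \<one>\<^bsub>T\<^esub> z"
      using that by (simp add: a_minus_def neg) (simp add: B)
    also have "tern T x \<one>\<^bsub>T\<^esub> (tern T \<one>\<^bsub>T\<^esub> y \<one>\<^bsub>T\<^esub>) = tern T x y \<one>\<^bsub>T\<^esub>"
      using that by (simp add: malcev flip: T.tern_assoc)
    also have "tern T (tern T x y \<one>\<^bsub>T\<^esub>) \<one>\<^bsub>T\<^esub> z = tern T x y z"
      using that by (simp add: malcev T.tern_assoc)
    finally show ?thesis .
  qed
  have "two_sided_brace_axioms ?B"
  proof
    fix a b c assume "a \<in> carrier ?B" "b \<in> carrier ?B" "c \<in> carrier ?B"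
    then have abc: "a \<in> carrier T" "b \<in> carrier T" "c \<in> carrier T"
      by (auto simp: B)
    have mult: "x \<otimes>\<^bsub>?B\<^esub> y = x \<otimes>\<^bsub>T\<^esub> y" and add: "x \<oplus>\<^bsub>?B\<^esub> y = tern T x \<one>\<^bsub>T\<^esub> y" for x y
      by (simp_all add: B)
    show "a \<otimes>\<^bsub>?B\<^esub> (b \<oplus>\<^bsub>?B\<^esub> c) = ((a \<otimes>\<^bsub>?B\<^esub> b) \<ominus>\<^bsub>?B\<^esub> a) \<oplus>\<^bsub>?B\<^esub> (a \<otimes>\<^bsub>?B\<^esub> c)"
      using abc by (simp add: mult sub_add) (simp add: add T.distrib_left)
    show "(b \<oplus>\<^bsub>?B\<^esub> c) \<otimes>\<^bsub>?B\<^esub> a = ((b \<otimes>\<^bsub>?B\<^esub> a) \<ominus>\<^bsub>?B\<^esub> a) \<oplus>\<^bsub>?B\<^esub> (c \<otimes>\<^bsub>?B\<^esub> a)"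
      using abc by (simp add: mult sub_add) (simp add: add T.distrib_right)
  qed
  with B_abelian B_group show ?thesis
    by (simp add: two_sided_brace_def)
qed

section \<open>The integer trusses and their quotients\<close>

lemma comm_unital_truss_int_truss: "comm_unital_truss (int_truss a)"
  by unfold_locales (auto simp: int_truss_def algebra_simps)

lemma int_multiples_iff: "x \<in> int_multiples N \<longleftrightarrow> N dvd x"
  by (auto simp: int_multiples_def dvd_def mult.commute)

lemma paragon_int_multiples: "paragon (int_multiples N) (int_truss a)"
  unfolding paragon_def
proof (intro conjI)
  show "\<exists>q\<in>int_multiples N. \<forall>x\<in>carrier (int_truss a). \<forall>p\<in>int_multiples N.
      tern (int_truss a) (x \<otimes>\<^bsub>int_truss a\<^esub> p) (x \<otimes>\<^bsub>int_truss a\<^esub> q) q \<in> int_multiples N \<and>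
      tern (int_truss a) (p \<otimes>\<^bsub>int_truss a\<^esub> x) (q \<otimes>\<^bsub>int_truss a\<^esub> x) q \<in> int_multiples N"
    \<comment> \<open>Since x * 0 = x in this truss, q = 0 turns the heap expressions into (axp + x
      + p) - x = (ax + 1)p, a multiple of p.\<close>
    by (rule bexI[of _ 0]) (auto simp: int_truss_def int_multiples_iff)
qed (auto simp: int_truss_def int_multiples_iff)

lemma paragon_rel_int_truss_iff:
  "(x, y) \<in> paragon_rel (int_truss a) (int_multiples N) \<longleftrightarrow> [x = y] (mod N)"
proof
  assume "(x, y) \<in> paragon_rel (int_truss a) (int_multiples N)"
  then obtain p where "N dvd p" "N dvd x - y + p"
    by (auto simp: paragon_rel_def int_truss_def int_multiples_iff)
  then show "[x = y] (mod N)"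
    by (simp add: cong_iff_dvd_diff dvd_add_left_iff)
next
  assume "[x = y] (mod N)"
  then show "(x, y) \<in> paragon_rel (int_truss a) (int_multiples N)"
    by (auto simp: paragon_rel_def int_truss_def int_multiples_iff cong_iff_dvd_diff
        intro!: exI[of _ 0])
qed

text \<open>The classes of the paragon relation do not depend on the parameter \<open>a\<close> of
  the truss, so they get a notation without it.\<close>

definition int_class :: "int \<Rightarrow> int \<Rightarrow> int set" where
  "int_class N x = {y. [x = y] (mod N)}"

lemma paragon_rel_int_truss_Image:
  "paragon_rel (int_truss a) (int_multiples N) `` {x} = int_class N x"
  by (auto simp: int_class_def paragon_rel_int_truss_iff)

lemma int_class_eq_iff: "int_class N x = int_class N y \<longleftrightarrow> [x = y] (mod N)"
  by (auto simp: int_class_def set_eq_iff intro: cong_sym cong_trans)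

lemma int_class_nonempty: "int_class N x \<noteq> {}"
  using cong_refl[of x N] unfolding int_class_def by blast

lemma carrier_quotient_int_truss:
  "carrier (quotient_truss (int_truss a) (int_multiples N)) = range (int_class N)"
proof -
  have "carrier (int_truss a) = UNIV"
    by (simp add: int_truss_def)
  then show ?thesis
    by (auto simp: quotient_truss_def quotient_def paragon_rel_int_truss_Image)
qed

lemma one_quotient_int_truss:
  "\<one>\<^bsub>quotient_truss (int_truss a) (int_multiples N)\<^esub> = int_class N 0"
  by (simp add: quotient_truss_def paragon_rel_int_truss_Image) (simp add: int_truss_def)

lemma mult_quotient_int_truss:
  "int_class N x \<otimes>\<^bsub>quotient_truss (int_truss a) (int_multiples N)\<^esub> int_class N y
    = int_class N (a * x * y + x + y)"
proof -
  \<comment> \<open>All classes in the defining union coincide. The index sets are nonempty, so the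
    union collapses to that single class.\<close>
  have "int_class N (a * u * v + u + v) = int_class N (a * x * y + x + y)"
    if "u \<in> int_class N x" "v \<in> int_class N y" for u v
    unfolding int_class_eq_iff
    by (intro cong_add cong_mult cong_refl) (use that in \<open>simp_all add: int_class_def cong_sym\<close>)
  then have "(\<Union>u\<in>int_class N x. \<Union>v\<in>int_class N y. int_class N (a * u * v + u + v))
      = int_class N (a * x * y + x + y)"
    by (simp add: int_class_nonempty cong: SUP_cong)
  then show ?thesis
    by (simp add: quotient_truss_def paragon_rel_int_truss_Image) (simp add: int_truss_def)
qed

lemma tern_quotient_int_truss:
  "tern (quotient_truss (int_truss a) (int_multiples N))
      (int_class N x) (int_class N y) (int_class N z)
    = int_class N (x - y + z)"
proof -
  have "int_class N (u - v + w) = int_class N (x - y + z)"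
    if "u \<in> int_class N x" "v \<in> int_class N y" "w \<in> int_class N z" for u v w
    unfolding int_class_eq_iff
    by (intro cong_add cong_diff) (use that in \<open>simp_all add: int_class_def cong_sym\<close>)
  then have "(\<Union>u\<in>int_class N x. \<Union>v\<in>int_class N y. \<Union>w\<in>int_class N z.
        int_class N (u - v + w))
      = int_class N (x - y + z)"
    by (simp add: int_class_nonempty cong: SUP_cong)
  then show ?thesis
    by (simp add: quotient_truss_def paragon_rel_int_truss_Image) (simp add: int_truss_def)
qed

lemmas quotient_int_truss_simps =
  carrier_quotient_int_truss one_quotient_int_truss mult_quotient_int_truss tern_quotient_int_truss

lemma unital_truss_quotient_int_truss:
  "unital_truss (quotient_truss (int_truss a) (int_multiples N))"
proof (rule unital_truss_image[of "int_truss a" _ "int_class N"])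
  show "unital_truss (int_truss a)"
    using comm_unital_truss_int_truss by (rule comm_unital_truss.axioms)
qed (simp_all add: quotient_int_truss_simps, simp_all add: int_truss_def)

section \<open>Odd residues modulo powers of two\<close>

text \<open>Doubling both the modulus and the difference preserves divisibility; this moves
  questions about classes to odd residues.\<close>

lemma int_class_eq_iff_odd: "int_class N x = int_class N y \<longleftrightarrow> [1 + 2 * x = 1 + 2 * y] (mod 2 * N)"
proof -
  have "(1 + 2 * x) - (1 + 2 * y) = 2 * (x - y)"
    by simp
  then show ?thesis
    by (metis cong_iff_dvd_diff dvd_mult_cancel_left int_class_eq_iff zero_neq_numeral)
qed

lemma Units_quotient_int_truss_2:
  fixes n :: nat
  defines "Q \<equiv> quotient_truss (int_truss 2) (int_multiples (2 ^ n))"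
  shows "Units Q = carrier Q"
proof
  show "carrier Q \<subseteq> Units Q"
  proof
    fix A assume A: "A \<in> carrier Q"
    then obtain x where x: "A = int_class (2 ^ n) x"
      by (auto simp: Q_def carrier_quotient_int_truss)
    have "coprime (1 + 2 * x) (2 * 2 ^ n)"
      by (simp flip: power_Suc)
    then obtain u where u: "[(1 + 2 * x) * u = 1] (mod 2 * 2 ^ n)"
      using cong_solve_coprime_int by blast
    \<comment> \<open>An inverse modulo an even number is odd, so it has the form 1 + 2y, and the
      class of y is the candidate inverse in the truss.\<close>
    then have "odd ((1 + 2 * x) * u)"
      using cong_dvd_modulus cong_dvd_iff by (metis dvd_triv_left odd_one)
    then obtain y where y: "u = 1 + 2 * y"
      by (metis add.commute even_mult_iff oddE)
    \<comment> \<open>Uses (1 + 2x)(1 + 2y) = 1 + 2(2xy + x + y).\<close>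
    have "int_class (2 ^ n) (2 * x * y + x + y) = int_class (2 ^ n) 0"
      using u unfolding int_class_eq_iff_odd y by (simp add: algebra_simps)
    then have "int_class (2 ^ n) y \<otimes>\<^bsub>Q\<^esub> A = \<one>\<^bsub>Q\<^esub>" "A \<otimes>\<^bsub>Q\<^esub> int_class (2 ^ n) y = \<one>\<^bsub>Q\<^esub>"
      by (simp_all add: Q_def x quotient_int_truss_simps algebra_simps)
    moreover have "int_class (2 ^ n) y \<in> carrier Q"
      by (simp add: Q_def carrier_quotient_int_truss)
    ultimately show "A \<in> Units Q"
      using A by (auto simp: Units_def)
  qed
qed (auto simp: Units_def)

text \<open>The order of 5 modulo \<open>2 ^ (k + 2)\<close> is \<open>2 ^ k\<close>, where k >= 1
  makes the exponent of the modulus at least 3. The congruence is first moved to the naturals, where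
  \<open>ord\<close> is taken.\<close>

lemma five_power_cong_iff:
  assumes "k \<ge> 1"
  shows "[5 ^ i = 5 ^ j] (mod (2 ^ (k + 2) :: int)) \<longleftrightarrow> [i = j] (mod 2 ^ k)"
proof -
  have "[5 ^ i = 5 ^ j] (mod (2 ^ (k + 2) :: int)) \<longleftrightarrow> [5 ^ i = 5 ^ j] (mod (2 ^ (k + 2) :: nat))"
    using cong_int_iff[of "5 ^ i" "5 ^ j" "2 ^ (k + 2)"] by simp
  also have "\<dots> \<longleftrightarrow> [i = j] (mod ord (2 ^ (k + 2)) (5 :: nat))"
    by (rule order_divides_expdiff) (simp only: coprime_power_left_iff, simp)
  also have "ord (2 ^ (k + 2)) (5 :: nat) = 2 ^ k"
    using ord_twopow_3_5[of "k + 2" 5] assms by simp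
  finally show ?thesis .
qed

text \<open>The argument is an integer pair because the cyclic groups have integer carriers; those
  are nonnegative, so \<open>nat\<close> loses nothing there.\<close>

definition odd_residue :: "int \<times> int \<Rightarrow> int" where
  "odd_residue p = (-1) ^ nat (fst p) * 5 ^ nat (snd p)"

lemma odd_odd_residue: "odd (odd_residue p)"
  by (simp add: odd_residue_def)

lemma inj_odd_residue:
  assumes k: "k \<ge> 1"
    and p: "p \<in> {0..<2} \<times> {0..<2 ^ k}" and q: "q \<in> {0..<2} \<times> {0..<2 ^ k}"
    and cong: "[odd_residue p = odd_residue q] (mod 2 ^ (k + 2))"
  shows "p = q"
proof -
  obtain i j i' j' where pq: "p = (i, j)" "q = (i', j')"
    by fastforce
  have bounds: "i = 0 \<or> i = 1" "i' = 0 \<or> i' = 1" "0 \<le> j" "j < 2 ^ k" "0 \<le> j'" "j' < 2 ^ k"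
    using p q by (auto simp: pq)
  \<comment> \<open>Modulo 4 the powers of 5 become 1 while 1 and -1 stay distinct, so the residue
    determines the first coordinate. Cancelling the common sign then leaves the powers of 5.\<close>
  have sign: "[odd_residue (a, b) = (-1) ^ nat a] (mod 4)" for a b
  proof -
    have "[5 ^ nat b = 1 ^ nat b] (mod (4 :: int))"
      by (rule cong_pow) (simp add: cong_def)
    then show ?thesis
      using cong_scalar_left[of "5 ^ nat b" "1 :: int" 4 "(-1) ^ nat a"]
      by (simp add: odd_residue_def)
  qed
  have "[odd_residue p = odd_residue q] (mod 4)"
    using cong_dvd_modulus[OF cong, of 4] by (simp add: power_add)
  then have "[(-1) ^ nat i = (-1 :: int) ^ nat i'] (mod 4)"
    using sign unfolding pq by (meson cong_sym cong_trans)
  then have i: "i = i'"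
    using bounds by (auto simp: cong_def)
  then have "[5 ^ nat j = 5 ^ nat j'] (mod (2 ^ (k + 2) :: int))"
    using cong bounds by (auto simp: pq odd_residue_def cong_minus_minus_iff)
  then have "[nat j = nat j'] (mod 2 ^ k)"
    using k five_power_cong_iff by blast
  moreover have "nat j < 2 ^ k" "nat j' < 2 ^ k"
    using bounds by (simp_all add: nat_less_iff)
  ultimately have "j = j'"
    using bounds by (simp add: cong_def)
  with i show ?thesis
    by (simp add: pq)
qed

text \<open>Powers of -1 depend on the exponent modulo 2, and powers of 5 modulo
  \<open>2 ^ (k + 2)\<close> on the exponent modulo \<open>2 ^ k\<close>, so reducing the exponents
  is harmless.\<close>

lemma odd_residue_mult:
  assumes k: "k \<ge> 1" and nonneg: "0 \<le> i" "0 \<le> i'" "0 \<le> j" "0 \<le> j'"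
  shows "[odd_residue ((i + i') mod 2, (j + j') mod 2 ^ k)
    = odd_residue (i, j) * odd_residue (i', j')] (mod 2 ^ (k + 2))"
proof -
  have "nat ((j + j') mod 2 ^ k) = (nat j + nat j') mod 2 ^ k"
    using nonneg by (simp add: nat_mod_distrib nat_add_distrib nat_power_eq)
  then have "[5 ^ nat ((j + j') mod 2 ^ k) = 5 ^ (nat j + nat j')] (mod (2 ^ (k + 2) :: int))"
    unfolding five_power_cong_iff[OF k] by (simp add: cong_def)
  moreover have "nat ((i + i') mod 2) = (nat i + nat i') mod 2"
    using nonneg by (simp add: nat_mod_distrib nat_add_distrib)
  then have "(-1 :: int) ^ nat ((i + i') mod 2) = (-1) ^ (nat i + nat i')"
    by (simp add: minus_one_power_iff)
  ultimately have "[(-1) ^ nat ((i + i') mod 2) * 5 ^ nat ((j + j') mod 2 ^ k)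
      = (-1) ^ (nat i + nat i') * 5 ^ (nat j + nat j')] (mod (2 ^ (k + 2) :: int))"
    by (simp add: cong_scalar_left)
  then show ?thesis
    by (simp add: odd_residue_def power_add ac_simps)
qed

lemma units_of_quotient_int_truss_2_iso:
  assumes k: "k \<ge> 1"
  defines "Q \<equiv> quotient_truss (int_truss 2) (int_multiples (2 ^ (k + 1)))"
  shows "units_of Q \<cong> integer_mod_group 2 \<times>\<times> integer_mod_group (2 ^ k)"
proof -
  let ?N = "2 ^ (k + 1) :: int"
  let ?G = "integer_mod_group 2 \<times>\<times> integer_mod_group (2 ^ k)"
  \<comment> \<open>This inverts m -> 1 + 2m; the division is exact because the residue is
    odd.\<close>
  define h where "h p = int_class ?N ((odd_residue p - 1) div 2)" for p
  have h_eq_iff: "h p = int_class ?N x \<longleftrightarrow> [odd_residue p = 1 + 2 * x] (mod 2 ^ (k + 2))" for p x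
    using odd_odd_residue[of p] by (simp add: h_def int_class_eq_iff_odd)
  have carrier_G: "carrier ?G = {0..<2} \<times> {0..<2 ^ k}"
    by (simp add: carrier_integer_mod_group)
  have carrier_U: "carrier (units_of Q) = range (int_class ?N)"
    using Units_quotient_int_truss_2[of "k + 1"]
    by (simp add: units_of_carrier Q_def carrier_quotient_int_truss)
  have "h \<in> hom ?G (units_of Q)"
  proof (rule homI)
    fix p q assume "p \<in> carrier ?G" "q \<in> carrier ?G"
    then obtain i j i' j' where pq: "p = (i, j)" "q = (i', j')"
      and nonneg: "0 \<le> i" "0 \<le> i'" "0 \<le> j" "0 \<le> j'"
      unfolding carrier_G by auto
    obtain x y where xy: "odd_residue p = 1 + 2 * x" "odd_residue q = 1 + 2 * y"
      using odd_odd_residue by (metis add.commute oddE)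
    \<comment> \<open>The right-hand side is (1 + 2x)(1 + 2y), so multiplying residues matches
      multiplying in the truss.\<close>
    have "[odd_residue (p \<otimes>\<^bsub>?G\<^esub> q) = 1 + 2 * (2 * x * y + x + y)] (mod 2 ^ (k + 2))"
      using odd_residue_mult[OF k nonneg] xy by (simp add: pq algebra_simps)
    then have "h (p \<otimes>\<^bsub>?G\<^esub> q) = int_class ?N (2 * x * y + x + y)"
      by (simp only: h_eq_iff)
    moreover have "h p = int_class ?N x" "h q = int_class ?N y"
      by (simp_all add: h_def xy)
    ultimately show "h (p \<otimes>\<^bsub>?G\<^esub> q) = h p \<otimes>\<^bsub>units_of Q\<^esub> h q"
      by (simp add: units_of_mult Q_def mult_quotient_int_truss)
  qed (simp add: carrier_U h_def)
  moreover have "bij_betw h (carrier ?G) (carrier (units_of Q))"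
    unfolding bij_betw_def
  proof
    show inj: "inj_on h (carrier ?G)"
    proof (rule inj_onI)
      fix p q assume p: "p \<in> carrier ?G" and q: "q \<in> carrier ?G" and "h p = h q"
      then have "[odd_residue p = odd_residue q] (mod 2 ^ (k + 2))"
        using odd_odd_residue[of q] h_eq_iff[of p "(odd_residue q - 1) div 2"]
        by (simp add: h_def[of q])
      with k p[unfolded carrier_G] q[unfolded carrier_G] show "p = q"
        by (rule inj_odd_residue)
    qed
    \<comment> \<open>Surjectivity follows by counting: there are at most \<open>2 ^ (k + 1)\<close>
      classes, and the injective \<open>h\<close> already takes 2 * \<open>2 ^ k\<close>
      values.\<close>
    have "int_class ?N x \<in> int_class ?N ` {0..<?N}" for x
      by (rule image_eqI[of _ _ "x mod ?N"]) (simp_all add: int_class_eq_iff cong_def)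
    then have U: "carrier (units_of Q) \<subseteq> int_class ?N ` {0..<?N}"
      by (auto simp: carrier_U)
    have "card (carrier (units_of Q)) \<le> card (int_class ?N ` {0..<?N})"
      by (rule card_mono[OF _ U]) simp
    also have "\<dots> \<le> card {0..<?N}"
      by (rule card_image_le) simp
    also have "\<dots> = card (carrier ?G)"
      by (simp add: carrier_integer_mod_group card_cartesian_product nat_power_eq nat_mult_distrib)
    also have "\<dots> = card (h ` carrier ?G)"
      by (simp only: card_image[OF inj])
    finally show "h ` carrier ?G = carrier (units_of Q)"
      using finite_subset[OF U] by (intro card_seteq) (auto simp: carrier_U h_def)
  qed
  ultimately have "?G \<cong> units_of Q"
    by (intro is_isoI isoI)
  then show ?thesis
    by (rule group.iso_sym[OF DirProd_group[OF group_integer_mod_group group_integer_mod_group]])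
qed

theorem proposition3p17:
  shows "(\<forall>a::int. a > 0 \<longrightarrow>
            comm_unital_truss (int_truss a) \<and>
            (\<forall>N::int. N > 0 \<longrightarrow> paragon (int_multiples N) (int_truss a))) \<and>
         (\<forall>k::nat. k \<ge> 1 \<longrightarrow>
            (let Q = quotient_truss (int_truss 2) (int_multiples (2 ^ (k + 1))) in
               unital_truss Q \<and>
               Units Q = carrier Q \<and>
               two_sided_brace (brace_of_truss Q) \<and>
               units_of Q \<cong> integer_mod_group 2 \<times>\<times> integer_mod_group (2 ^ k)))"
  unfolding Let_def
  by (intro conjI allI impI comm_unital_truss_int_truss paragon_int_multiples
      unital_truss_quotient_int_truss Units_quotient_int_truss_2 two_sided_brace_brace_of_truss
      units_of_quotient_int_truss_2_iso)

end
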